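(* Let $\mathbf F$ be a field with a discrete nontrivial non-Archimedean valuation, spherically complete, and let $H$ be a Banach space over $\mathbf F$. Let $1\le q,r,v\le\infty$ with $1/q+1/r=1/v$. If $J\in L_q(H)$ and $S\in L_r(H)$ are commuting operators, then $JS\in L_v(H)$.
   Context: $L_q(H):=L_q(H,H)$. For $1\le q<\infty$, $L_q(E,H)$ is the set of bounded $\mathbf F$-linear operators $A:E\to H$ of the form $Ax=\sum_{n=1}^\infty a_n(x)y_n$ for all $x\in E$, with $a_n\in E^*$, $y_n\in H$ and $\sum_{n=1}^\infty\|a_n\|_{E^*}^q\|y_n\|_H^q<\infty$; $L_\infty(E,H):=L(E,H)$ is the space of all bounded linear operators. $E^*$ is the space of continuous linear functionals on $E$. *)

theory Defs
  imports "HOL-Analysis.Analysis"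
begin

text \<open>
  The scalar field is a type \<^typ>\<open>'f::field\<close> with an explicit absolute value, and normed spaces over
  it are types with an explicit scalar multiplication and norm, because the library's normed type
  classes are tied to real scalars. A (multiplicatively written) non-Archimedean valuation is an
  absolute value satisfying the ultrametric inequality.
\<close>

locale na_valued_field =
  fixes absv :: "'f::field \<Rightarrow> real"
  assumes absv_nonneg: "0 \<le> absv a"
    and absv_eq_0_iff: "absv a = 0 \<longleftrightarrow> a = 0"
    and absv_mult: "absv (a * b) = absv a * absv b"
    and absv_add_le: "absv (a + b) \<le> max (absv a) (absv b)"

locale na_normed_space = na_valued_field absv + vector_space scale
  for absv :: "'f::field \<Rightarrow> real"
    and scale :: "'f \<Rightarrow> 'e::ab_group_add \<Rightarrow> 'e" +
  fixes nrm :: "'e \<Rightarrow> real"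
  assumes nrm_nonneg: "0 \<le> nrm x"
    and nrm_eq_0_iff: "nrm x = 0 \<longleftrightarrow> x = 0"
    and nrm_scale: "nrm (scale a x) = absv a * nrm x"
    and nrm_add_le: "nrm (x + y) \<le> max (nrm x) (nrm y)"

definition norm_dist :: "('a::ab_group_add \<Rightarrow> real) \<Rightarrow> 'a \<Rightarrow> 'a \<Rightarrow> real" where
  "norm_dist N x y = N (x - y)"

definition norm_topology :: "('a::ab_group_add \<Rightarrow> real) \<Rightarrow> 'a topology" where
  "norm_topology N = Metric_space.mtopology UNIV (norm_dist N)"

locale na_banach_space = na_normed_space absv scale nrm
  for absv :: "'f::field \<Rightarrow> real"
    and scale :: "'f \<Rightarrow> 'e::ab_group_add \<Rightarrow> 'e"
    and nrm :: "'e \<Rightarrow> real" +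
  assumes nrm_complete: "Metric_space.mcomplete UNIV (norm_dist nrm)"

definition nontrivial_valuation :: "('f::field \<Rightarrow> real) \<Rightarrow> bool" where
  "nontrivial_valuation absv \<longleftrightarrow> (\<exists>a. a \<noteq> 0 \<and> absv a \<noteq> 1)"

text \<open>The value group \<open>{|a| : a \<noteq> 0}\<close> is required to be a discrete subset of \<open>(0,\<infinity>)\<close>;
  \<open>0\<close>, at which it accumulates for nontrivial valuations, does not belong to it.\<close>

definition discrete_valuation :: "('f::field \<Rightarrow> real) \<Rightarrow> bool" where
  "discrete_valuation absv \<longleftrightarrow> discrete (absv ` (UNIV - {0}))"

text \<open>Negative radii are excluded since the library's \<open>mcball\<close> is then empty.\<close>

definition spherically_complete :: "('a::ab_group_add \<Rightarrow> real) \<Rightarrow> bool" where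
  "spherically_complete N \<longleftrightarrow>
    (\<forall>c r. (\<forall>n::nat. 0 \<le> r n) \<and>
           decseq (\<lambda>n. Metric_space.mcball UNIV (norm_dist N) (c n) (r n)) \<longrightarrow>
           (\<Inter>n. Metric_space.mcball UNIV (norm_dist N) (c n) (r n)) \<noteq> {})"

definition bounded_ops ::
  "('f::field \<Rightarrow> 'e::ab_group_add \<Rightarrow> 'e) \<Rightarrow> ('e \<Rightarrow> real) \<Rightarrow>
   ('f \<Rightarrow> 'h::ab_group_add \<Rightarrow> 'h) \<Rightarrow> ('h \<Rightarrow> real) \<Rightarrow> ('e \<Rightarrow> 'h) set" where
  "bounded_ops scaleE normE scaleH normH =
    {A. Vector_Spaces.linear scaleE scaleH A \<and> (\<exists>C. \<forall>x. normH (A x) \<le> C * normE x)}"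

definition dual_space ::
  "('f::field \<Rightarrow> real) \<Rightarrow> ('f \<Rightarrow> 'e::ab_group_add \<Rightarrow> 'e) \<Rightarrow> ('e \<Rightarrow> real) \<Rightarrow> ('e \<Rightarrow> 'f) set" where
  "dual_space absv scaleE normE =
    {a. Vector_Spaces.linear scaleE (*) a \<and>
        continuous_map (norm_topology normE) (norm_topology absv) a}"

text \<open>As in the library's \<open>onorm\<close>, the supremum runs over all \<open>x\<close>; the term for \<open>x = 0\<close> is
  \<open>0 / 0 = 0\<close>, so the norm is also correct on the zero space.\<close>

definition dual_norm ::
  "('f::field \<Rightarrow> real) \<Rightarrow> ('e::ab_group_add \<Rightarrow> real) \<Rightarrow> ('e \<Rightarrow> 'f) \<Rightarrow> real" where
  "dual_norm absv normE a = (SUP x. absv (a x) / normE x)"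

text \<open>\<open>L_op q\<close> is \<open>L\<^sub>q(E,H)\<close>, meaningful for \<open>1 \<le> q \<le> \<infinity>\<close>. The series are indexed from \<open>0\<close>.\<close>

definition L_op ::
  "ennreal \<Rightarrow> ('f::field \<Rightarrow> real) \<Rightarrow>
   ('f \<Rightarrow> 'e::ab_group_add \<Rightarrow> 'e) \<Rightarrow> ('e \<Rightarrow> real) \<Rightarrow>
   ('f \<Rightarrow> 'h::ab_group_add \<Rightarrow> 'h) \<Rightarrow> ('h \<Rightarrow> real) \<Rightarrow> ('e \<Rightarrow> 'h) set" where
  "L_op q absv scaleE normE scaleH normH =
    (if q = \<infinity> then bounded_ops scaleE normE scaleH normH
     else {A \<in> bounded_ops scaleE normE scaleH normH.
            \<exists>(a :: nat \<Rightarrow> 'e \<Rightarrow> 'f) (y :: nat \<Rightarrow> 'h).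
              (\<forall>n. a n \<in> dual_space absv scaleE normE) \<and>
              (\<forall>x. limitin (norm_topology normH)
                     (\<lambda>N. \<Sum>n<N. scaleH (a n x) (y n)) (A x) sequentially) \<and>
              summable (\<lambda>n. dual_norm absv normE (a n) powr enn2real q
                             * normH (y n) powr enn2real q)})"

end

theory Submission
  imports Defs
begin

text \<open>
  If \<open>q\<close> and \<open>r\<close> are both infinite, so is \<open>v\<close>, and a composition of bounded operators is bounded. If
  exactly one of them is infinite, the other one equals \<open>v\<close> and the claim is the ideal property: composing a nuclear-type
  series \<open>\<Sum> a\<^sub>n(x) y\<^sub>n\<close> with a bounded operator \<open>T\<close> on the right replaces \<open>a\<^sub>n\<close> by \<open>a\<^sub>n \<circ> T\<close>, on the
  left it replaces \<open>y\<^sub>n\<close> by \<open>T y\<^sub>n\<close>, and the coefficients grow at most by the factor \<open>\<parallel>T\<parallel>\<close>.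

  For finite \<open>q\<close> and \<open>r\<close> the class \<open>L\<^sub>q\<close> is, over a spherically complete field, the analogue of the
  Schatten class: its members are the operators that admit approximations \<open>F\<^sub>n\<close> of rank at most a
  fixed multiple of \<open>n\<close> with decreasing errors \<open>\<parallel>A - F\<^sub>n\<parallel> \<le> c\<^sub>n\<close> such that \<open>\<Sum> c\<^sub>n\<^sup>q < \<infinity>\<close>. In one direction
  (\<open>L_op_approximation\<close>) let \<open>F\<^sub>n\<close> consist of the \<open>n\<close> terms of a series for \<open>A\<close> with the largest
  coefficients; by the ultrametric inequality the rest of the series is bounded by its largest
  term, so \<open>c\<^sub>n\<close> is the decreasing rearrangement of the coefficients.

  The converse (\<open>L_op_of_approximation\<close>) rests on the fact that an operator of rank \<open>N\<close> is a sum of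
  \<open>N\<close> rank-one operators, none of which has a larger norm than the operator itself
  (\<open>finite_rank_representation\<close>). Indeed, best approximations in a finite-dimensional subspace exist
  by spherical completeness, so a Gram--Schmidt process gives an orthogonal basis of the range, and
  the coordinates in an orthogonal basis do not exceed the norm. The constant is independent of
  \<open>N\<close>, and this makes it possible to expand the dyadic blocks \<open>F\<^sub>n - F\<^sub>m\<close> with \<open>n = 2\<^sup>k\<^sup>+\<^sup>1\<close>, \<open>m = 2\<^sup>k\<close>:
  such a block has rank \<open>O(m)\<close> and norm at most \<open>c\<^sub>m\<close>, so it contributes \<open>O(m c\<^sub>m\<^sup>v)\<close> to the
  series of \<open>v\<close>-th powers, and Cauchy condensation bounds the sum of these numbers.

  The characterization is multiplicative. If \<open>F\<^sub>n\<close> and \<open>F'\<^sub>n\<close> approximate \<open>J\<close> and \<open>S\<close> up to \<open>c\<^sub>n\<close> and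
  \<open>d\<^sub>n\<close>, then \<open>(J - F\<^sub>n) (S - F'\<^sub>n)\<close> differs from \<open>J S\<close> by an operator of rank at most \<open>2 n\<close>, and its
  norm is at most \<open>c\<^sub>n d\<^sub>n\<close>. Hoelder's inequality puts the products \<open>c\<^sub>n d\<^sub>n\<close> into \<open>\<ell>\<^sup>v\<close>.
\<close>

section \<open>Real sequences and reciprocal exponents\<close>

lemma ennreal_inverse_inject:
  fixes x y :: ennreal
  shows "inverse x = inverse y \<longleftrightarrow> x = y"
proof -
  have "inverse (inverse z) = z" for z :: ennreal
  proof (cases "z = 0 \<or> z = top")
    case False
    then obtain t where "z = ennreal t" "0 < t"
      by (cases z) (auto simp: less_le)
    then show ?thesis
      by (simp add: inverse_ennreal)
  qed auto
  then show ?thesis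
    by metis
qed

lemma tendsto_zero_if_summable_powr:
  fixes c :: "nat \<Rightarrow> real"
  assumes "0 < p" "\<And>n. 0 \<le> c n" "summable (\<lambda>n. c n powr p)"
  shows "c \<longlonglongrightarrow> 0"
proof -
  have "(\<lambda>n. (c n powr p) powr (1 / p)) \<longlonglongrightarrow> 0"
    using assms by (intro tendsto_zero_powrI[OF summable_LIMSEQ_zero[OF assms(3)] tendsto_const]) auto
  then show ?thesis
    using assms by (simp add: powr_powr)
qed

text \<open>
  The enumeration \<open>\<sigma>\<close> lists indices by decreasing value. It need not be surjective: if \<open>c\<close> has
  infinitely many positive values, the indices of its zeros are never reached.
\<close>

lemma decreasing_enumeration:
  fixes c :: "nat \<Rightarrow> real"
  assumes c: "\<And>n. 0 \<le> c n" "c \<longlonglongrightarrow> 0"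
  shows "\<exists>\<sigma> :: nat \<Rightarrow> nat. inj \<sigma> \<and> (\<forall>n i. i \<notin> \<sigma> ` {..<n} \<longrightarrow> c i \<le> c (\<sigma> n))"
proof -
  \<comment> \<open>A largest value outside \<open>X\<close> is attained, because only finitely many values exceed a positive one.\<close>
  have "\<exists>m. m \<notin> X \<and> (\<forall>l. l \<notin> X \<longrightarrow> c l \<le> c m)" if X: "finite X" for X
  proof (cases "\<forall>l. l \<notin> X \<longrightarrow> c l = 0")
    case True
    then show ?thesis
      using ex_new_if_finite[OF infinite_UNIV_nat X] by fastforce
  next
    case False
    then obtain p where p: "p \<notin> X" "0 < c p"
      using c(1) by (metis order_le_less)
    define Z where "Z = {l. l \<notin> X \<and> c p \<le> c l}"
    have "\<forall>\<^sub>F n in sequentially. c n < c p"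
      using p(2) by (rule order_tendstoD(2)[OF c(2)])
    then obtain M where "\<And>n. M \<le> n \<Longrightarrow> c n < c p"
      by (auto simp: eventually_sequentially)
    then have "Z \<subseteq> {..<M}"
      unfolding Z_def by (auto simp: not_le[symmetric])
    then have Z: "finite Z" "Z \<noteq> {}"
      using p by (auto simp: Z_def intro: finite_subset)
    then have "Max (c ` Z) \<in> c ` Z"
      by simp
    then obtain m where m: "m \<in> Z" "Max (c ` Z) = c m"
      by auto
    have "c l \<le> c m" if "l \<notin> X" for l
    proof (cases "c p \<le> c l")
      case True
      then have "c l \<in> c ` Z"
        using that by (simp add: Z_def)
      then show ?thesis
        using Z m by (metis Max_ge finite_imageI)
    next
      case False
      then show ?thesis
        using m by (simp add: Z_def)
    qed
    then show ?thesis
      using m by (auto simp: Z_def)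
  qed
  then obtain \<mu> where \<mu>: "\<And>X. finite X \<Longrightarrow> \<mu> X \<notin> X" "\<And>X l. finite X \<Longrightarrow> l \<notin> X \<Longrightarrow> c l \<le> c (\<mu> X)"
    by metis
  define Xs where "Xs = rec_nat {} (\<lambda>_ X. insert (\<mu> X) X)"
  define \<sigma> where "\<sigma> n = \<mu> (Xs n)" for n
  have Xs: "Xs n = \<sigma> ` {..<n}" for n
    by (induction n) (auto simp: Xs_def \<sigma>_def lessThan_Suc)
  have \<sigma>: "\<sigma> n \<notin> \<sigma> ` {..<n}" "i \<notin> \<sigma> ` {..<n} \<Longrightarrow> c i \<le> c (\<sigma> n)" for n i
    using \<mu>[of "\<sigma> ` {..<n}"] by (auto simp: \<sigma>_def[of n] Xs)
  have "inj \<sigma>"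
  proof (rule linorder_injI)
    show "\<sigma> m \<noteq> \<sigma> n" if "m < n" for m n
      using \<sigma>(1)[of n] that by (metis imageI lessThan_iff)
  qed
  show ?thesis
    by (rule exI[of _ \<sigma>]) (simp add: \<open>inj \<sigma>\<close> \<sigma>(2))
qed

text \<open>
  Hoelder's inequality for powers, by the pointwise bound \<open>(c d)\<^sup>v \<le> max (c\<^sup>q) (d\<^sup>r)\<close>: with \<open>m\<close> for the
  maximum, \<open>c \<le> m\<^sup>1\<^sup>/\<^sup>q\<close> and \<open>d \<le> m\<^sup>1\<^sup>/\<^sup>r\<close>.
\<close>

lemma summable_powr_mult:
  fixes c d :: "nat \<Rightarrow> real"
  assumes "0 < q" "0 < r" "0 < v" "1 / q + 1 / r = 1 / v"
    and "\<And>n. 0 \<le> c n" "\<And>n. 0 \<le> d n"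
    and "summable (\<lambda>n. c n powr q)" "summable (\<lambda>n. d n powr r)"
  shows "summable (\<lambda>n. (c n * d n) powr v)"
proof (rule summable_comparison_test'[OF summable_add[OF assms(7,8)]])
  fix n
  define m where "m = max (c n powr q) (d n powr r)"
  have "(c n powr q) powr (1 / q) \<le> m powr (1 / q)" "(d n powr r) powr (1 / r) \<le> m powr (1 / r)"
    using assms(1,2) by (intro powr_mono2; simp add: m_def)+
  then have "c n \<le> m powr (1 / q)" "d n \<le> m powr (1 / r)"
    using assms(1,2,5,6) by (simp_all add: powr_powr)
  then have "c n * d n \<le> m powr (1 / q) * m powr (1 / r)"
    using assms by (intro mult_mono) auto
  also have "\<dots> = m powr (1 / v)"
    using assms(4) by (simp flip: powr_add)
  finally have "(c n * d n) powr v \<le> (m powr (1 / v)) powr v"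
    using assms by (intro powr_mono2) auto
  also have "\<dots> = m"
    using assms by (simp add: powr_powr m_def max_def)
  also have "\<dots> \<le> c n powr q + d n powr r"
    by (simp add: m_def)
  finally show "norm ((c n * d n) powr v) \<le> c n powr q + d n powr r"
    by simp
qed

section \<open>Ultrametric norms and bounded operators\<close>

text \<open>The scalar field is treated as a one-dimensional normed space, so that functionals are operators.\<close>

lemma (in na_valued_field) field_normed_space: "na_normed_space absv (*) absv"
  by unfold_locales
     (auto simp: absv_nonneg absv_eq_0_iff absv_mult absv_add_le algebra_simps)

context na_normed_space
begin

lemma nrm_zero [simp]: "nrm 0 = 0"
  by (simp add: nrm_eq_0_iff)

lemma absv_one [simp]: "absv 1 = 1"
  using absv_mult[of 1 1] absv_eq_0_iff[of 1] by simp

lemma absv_minus_one [simp]: "absv (- 1) = 1"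
proof -
  have "(absv (- 1))\<^sup>2 = 1"
    using absv_mult[of "- 1" "- 1"] by (simp add: power2_eq_square)
  then show ?thesis
    using absv_nonneg[of "- 1"] by (simp add: power2_eq_1_iff)
qed

lemma nrm_minus [simp]: "nrm (- x) = nrm x"
  using nrm_scale[of "- 1" x] by simp

lemma nrm_minus_commute: "nrm (x - y) = nrm (y - x)"
  using nrm_minus[of "x - y"] by simp

lemma nrm_diff_le: "nrm (x - y) \<le> max (nrm x) (nrm y)"
  using nrm_add_le[of x "- y"] by simp

lemma nrm_triangle_le: "nrm (x - z) \<le> max (nrm (x - y)) (nrm (y - z))"
  using nrm_add_le[of "x - y" "y - z"] by simp

text \<open>
  The bound \<open>B\<close> does not depend on the number of summands, so the rest of a series is no larger than
  its largest term.
\<close>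

lemma nrm_sum_le:
  assumes "0 \<le> B" and "\<And>i. i \<in> I \<Longrightarrow> nrm (f i) \<le> B"
  shows "nrm (sum f I) \<le> B"
  using assms(2)
proof (induction I rule: infinite_finite_induct)
  case (insert i I)
  have "nrm (f i + sum f I) \<le> max (nrm (f i)) (nrm (sum f I))"
    by (rule nrm_add_le)
  also have "\<dots> \<le> B"
    using insert by simp
  finally show ?case
    using insert.hyps by simp
qed (use assms(1) in auto)

lemma metric_space_nrm: "Metric_space UNIV (norm_dist nrm)"
proof
  fix x y z
  show "norm_dist nrm x z \<le> norm_dist nrm x y + norm_dist nrm y z"
    using nrm_triangle_le[of x z y] nrm_nonneg[of "x - y"] nrm_nonneg[of "y - z"]
    by (simp add: norm_dist_def)
qed (auto simp: norm_dist_def nrm_nonneg nrm_eq_0_iff nrm_minus_commute)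

lemma limitin_norm_topology_iff:
  "limitin (norm_topology nrm) f l sequentially \<longleftrightarrow> (\<lambda>n. nrm (f n - l)) \<longlonglongrightarrow> 0"
  using nrm_nonneg
  by (simp add: norm_topology_def Metric_space.limit_metric_sequentially[OF metric_space_nrm]
      norm_dist_def LIMSEQ_iff)

lemma mcball_norm_dist:
  "0 \<le> \<rho> \<Longrightarrow> Metric_space.mcball UNIV (norm_dist nrm) c \<rho> = {x. nrm (x - c) \<le> \<rho>}"
  by (auto simp: Metric_space.mcball_def[OF metric_space_nrm] norm_dist_def nrm_minus_commute)

lemma bounded_opsE:
  assumes "T \<in> bounded_ops scale nrm s N"
  obtains C where "0 \<le> C" "\<And>x. N (T x) \<le> C * nrm x"
proof -
  obtain C where C: "\<And>x. N (T x) \<le> C * nrm x"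
    using assms by (auto simp: bounded_ops_def)
  have "C * nrm x \<le> max C 0 * nrm x" for x
    by (intro mult_right_mono) (auto simp: nrm_nonneg)
  with C have "N (T x) \<le> max C 0 * nrm x" for x
    by (meson order_trans)
  then show ?thesis
    by (intro that[of "max C 0"]) auto
qed

lemma bounded_opsI:
  assumes "Vector_Spaces.linear scale s T" and "\<And>x. N (T x) \<le> C * nrm x"
  shows "T \<in> bounded_ops scale nrm s N"
  using assms by (auto simp: bounded_ops_def)

lemma bounded_ops_linear: "T \<in> bounded_ops scale nrm s N \<Longrightarrow> Vector_Spaces.linear scale s T"
  by (simp add: bounded_ops_def)

lemma bounded_ops_compose:
  assumes "T \<in> bounded_ops scale nrm s N" "S \<in> bounded_ops scale nrm scale nrm"
  shows "T \<circ> S \<in> bounded_ops scale nrm s N"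
proof -
  obtain C where C: "0 \<le> C" "\<And>x. N (T x) \<le> C * nrm x"
    using bounded_opsE[OF assms(1)] by metis
  obtain D where D: "0 \<le> D" "\<And>x. nrm (S x) \<le> D * nrm x"
    using bounded_opsE[OF assms(2)] by metis
  show ?thesis
  proof (rule bounded_opsI[where C = "C * D"])
    show "Vector_Spaces.linear scale s (T \<circ> S)"
      using assms by (intro Vector_Spaces.linear_compose) (auto simp: bounded_ops_def)
    show "N ((T \<circ> S) x) \<le> C * D * nrm x" for x
      using order_trans[OF C(2)[of "S x"] mult_left_mono[OF D(2)[of x] C(1)]] by (simp add: mult.assoc)
  qed
qed

lemma bounded_ops_add:
  assumes "T \<in> bounded_ops scale nrm scale nrm" "S \<in> bounded_ops scale nrm scale nrm"
  shows "(\<lambda>x. T x + S x) \<in> bounded_ops scale nrm scale nrm"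
proof -
  obtain C where C: "0 \<le> C" "\<And>x. nrm (T x) \<le> C * nrm x"
    using bounded_opsE[OF assms(1)] by metis
  obtain D where D: "0 \<le> D" "\<And>x. nrm (S x) \<le> D * nrm x"
    using bounded_opsE[OF assms(2)] by metis
  show ?thesis
  proof (rule bounded_opsI[where C = "max C D"])
    show "Vector_Spaces.linear scale scale (\<lambda>x. T x + S x)"
      using assms unfolding bounded_ops_def Vector_Spaces.linear_iff
      by (auto simp: algebra_simps scale_right_distrib)
    show "nrm (T x + S x) \<le> max C D * nrm x" for x
    proof -
      have "nrm (T x) \<le> max C D * nrm x" "nrm (S x) \<le> max C D * nrm x"
        using C(2)[of x] D(2)[of x] nrm_nonneg[of x]
        by (meson max.cobounded1 max.cobounded2 mult_right_mono order_trans)+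
      then show ?thesis
        using nrm_add_le[of "T x" "S x"] by linarith
    qed
  qed
qed

lemma bounded_ops_uminus:
  assumes "T \<in> bounded_ops scale nrm scale nrm"
  shows "(\<lambda>x. - T x) \<in> bounded_ops scale nrm scale nrm"
  using assms unfolding bounded_ops_def Vector_Spaces.linear_iff by auto

lemma bounded_ops_diff:
  assumes "T \<in> bounded_ops scale nrm scale nrm" "S \<in> bounded_ops scale nrm scale nrm"
  shows "(\<lambda>x. T x - S x) \<in> bounded_ops scale nrm scale nrm"
  using bounded_ops_add[OF assms(1) bounded_ops_uminus[OF assms(2)]] by simp

lemma bounded_ops_zero: "(\<lambda>x. 0) \<in> bounded_ops scale nrm scale nrm"
  by (rule bounded_opsI[where C = 0]) (auto simp: Vector_Spaces.linear_iff vector_space_axioms)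

lemma bounded_ops_sum:
  assumes "\<And>i. i \<in> I \<Longrightarrow> T i \<in> bounded_ops scale nrm scale nrm"
  shows "(\<lambda>x. \<Sum>i\<in>I. T i x) \<in> bounded_ops scale nrm scale nrm"
  using assms
  by (induction I rule: infinite_finite_induct) (auto simp: bounded_ops_zero intro: bounded_ops_add)

lemma bounded_ops_rank_one:
  assumes "a \<in> bounded_ops scale nrm (*) absv"
  shows "(\<lambda>x. scale (a x) y) \<in> bounded_ops scale nrm scale nrm"
proof -
  obtain C where C: "0 \<le> C" "\<And>x. absv (a x) \<le> C * nrm x"
    using bounded_opsE[OF assms] by metis
  show ?thesis
  proof (rule bounded_opsI[where C = "C * nrm y"])
    show "Vector_Spaces.linear scale scale (\<lambda>x. scale (a x) y)"
      using assms unfolding bounded_ops_def Vector_Spaces.linear_iff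
      by (auto simp: scale_left_distrib)
    show "nrm (scale (a x) y) \<le> C * nrm y * nrm x" for x
      using mult_right_mono[OF C(2)[of x] nrm_nonneg[of y]] by (simp add: nrm_scale mult_ac)
  qed
qed

section \<open>Functionals and the dual norm\<close>

text \<open>
  A functional that is less than \<open>1\<close> on a ball of radius \<open>d\<close> is bounded because nontriviality provides a
  scalar \<open>p\<close> with \<open>\<bar>p\<bar> > 1\<close>: every nonzero vector can be scaled by a power of \<open>p\<close> into that ball,
  but not below the radius \<open>d / \<bar>p\<bar>\<close>.
\<close>

lemma dual_space_eq_bounded:
  assumes "nontrivial_valuation absv"
  shows "dual_space absv scale nrm = bounded_ops scale nrm (*) absv"
proof -
  interpret fld: na_normed_space absv "(*)" absv
    by (rule field_normed_space)
  have cont: "continuous_map (norm_topology nrm) (norm_topology absv) a \<longleftrightarrow>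
      (\<forall>x. \<forall>e>0. \<exists>d>0. \<forall>y. nrm (x - y) < d \<longrightarrow> absv (a x - a y) < e)" for a
    unfolding norm_topology_def
    by (subst Metric_space.metric_continuous_map[OF metric_space_nrm fld.metric_space_nrm])
       (auto simp: norm_dist_def)
  obtain p where p: "p \<noteq> 0" "1 < absv p"
  proof -
    obtain b where b: "b \<noteq> 0" "absv b \<noteq> 1"
      using assms by (auto simp: nontrivial_valuation_def)
    have "absv b * absv (inverse b) = 1"
      using b absv_mult[of b "inverse b"] by simp
    then have "1 < absv b \<or> 1 < absv (inverse b)"
      using b(2) absv_nonneg[of b] absv_nonneg[of "inverse b"]
      by (metis linorder_neqE_linordered_idom mult_le_one mult_less_cancel_right1 mult.commute
          less_eq_real_def not_less mult_cancel_left1 mult_zero_left)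
    then show ?thesis
      using that b by (metis inverse_nonzero_iff_nonzero)
  qed
  have "(\<exists>C. \<forall>x. absv (a x) \<le> C * nrm x)"
    if lin: "Vector_Spaces.linear scale (*) a"
      and c: "continuous_map (norm_topology nrm) (norm_topology absv) a" for a
  proof -
    have hom: "a (scale c x) = c * a x" for c x
      using lin by (auto simp: Vector_Spaces.linear_iff)
    have a0: "a 0 = 0"
      using hom[of 0 0] by simp
    obtain d where d: "d > 0" "\<And>y. nrm y < d \<Longrightarrow> absv (a y) < 1"
      using c[unfolded cont, rule_format, of 1 0] a0 by auto
    have pow: "absv (p powi n) = absv p powi n" for n
    proof -
      have nat: "absv (p ^ k) = absv p ^ k" for k
        by (induction k) (auto simp: absv_mult)
      have inv: "absv (inverse y) = inverse (absv y)" for y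
        using absv_mult[of y "inverse y"] absv_eq_0_iff[of y]
        by (cases "y = 0") (auto simp: field_simps absv_eq_0_iff inverse_eq_divide)
      show ?thesis
        by (simp add: power_int_def nat inv power_inverse)
    qed
    have "absv (a x) \<le> (absv p / d) * nrm x" for x
    proof (cases "x = 0")
      case False
      then have x: "nrm x > 0"
        using nrm_nonneg[of x] nrm_eq_0_iff[of x] by linarith
      \<comment> \<open>\<open>n\<close> is the largest integer with \<open>\<bar>p\<bar>\<^sup>n \<parallel>x\<parallel> < d\<close>.\<close>
      define t where "t = log (absv p) (d / nrm x)"
      define n where "n = \<lceil>t\<rceil> - 1"
      have powr: "absv p powi k = absv p powr of_int k" for k
        using p by (simp add: powr_real_of_int')
      have t: "absv p powr t = d / nrm x"
        unfolding t_def using p x d by simp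
      have n: "of_int n < t" "t \<le> of_int n + 1"
        unfolding n_def by linarith+
      have lo: "absv p powi n < d / nrm x"
        unfolding powr t[symmetric] using n p by simp
      have "d / nrm x \<le> absv p powr (of_int n + 1)"
        unfolding t[symmetric] using n p by simp
      then have hi: "d / nrm x \<le> absv p powi n * absv p"
        using p by (simp add: powr powr_add)
      have "absv (a (scale (p powi n) x)) < 1"
        using lo x by (intro d(2)) (simp add: nrm_scale pow field_simps)
      then have "absv p powi n * absv (a x) < 1"
        by (simp add: hom absv_mult pow)
      moreover have pos: "absv p powi n > 0"
        using p by simp
      ultimately have "absv (a x) < 1 / absv p powi n"
        by (simp add: field_simps)
      also have "\<dots> \<le> (absv p / d) * nrm x"
        using hi pos x d p by (simp add: field_simps)
      finally show ?thesis
        by simp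
    qed (simp add: a0)
    then show ?thesis
      by blast
  qed
  moreover have "continuous_map (norm_topology nrm) (norm_topology absv) a"
    if bdd: "a \<in> bounded_ops scale nrm (*) absv" for a
  proof -
    obtain C where C: "0 \<le> C" "\<And>x. absv (a x) \<le> C * nrm x"
      using bounded_opsE[OF bdd] by metis
    have sub: "a x - a y = a (x - y)" for x y
      using Vector_Spaces.linear.axioms(3)[OF bounded_ops_linear[OF bdd]]
      by (simp add: module_hom.diff)
    have "\<exists>d>0. \<forall>y. nrm (x - y) < d \<longrightarrow> absv (a x - a y) < e" if "e > 0" for x e
    proof (intro exI[of _ "e / (C + 1)"] conjI allI impI)
      fix y
      assume y: "nrm (x - y) < e / (C + 1)"
      have "absv (a x - a y) \<le> C * nrm (x - y)"
        by (simp add: sub C)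
      also have "\<dots> \<le> (C + 1) * nrm (x - y)"
        by (simp add: nrm_nonneg algebra_simps)
      also have "\<dots> < e"
        using y C(1) by (simp add: field_simps)
      finally show "absv (a x - a y) < e" .
    qed (use C that in auto)
    then show ?thesis
      by (simp add: cont)
  qed
  ultimately show ?thesis
    by (auto simp: dual_space_def bounded_ops_def)
qed

lemma bdd_above_dual_norm:
  assumes "a \<in> bounded_ops scale nrm (*) absv"
  shows "bdd_above (range (\<lambda>x. absv (a x) / nrm x))"
proof -
  obtain C where C: "0 \<le> C" "\<And>x. absv (a x) \<le> C * nrm x"
    using bounded_opsE[OF assms] by metis
  have "absv (a x) / nrm x \<le> C" for x
    using C(2)[of x] C(1) nrm_nonneg[of x] by (cases "nrm x = 0") (auto simp: divide_le_eq)
  then show ?thesis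
    by (auto intro!: bdd_aboveI)
qed

lemma absv_le_dual_norm:
  assumes "a \<in> bounded_ops scale nrm (*) absv"
  shows "absv (a x) \<le> dual_norm absv nrm a * nrm x"
proof (cases "x = 0")
  case True
  then show ?thesis
    using bounded_opsE[OF assms] absv_nonneg by (metis mult_zero_right nrm_zero)
next
  case False
  then have "nrm x > 0"
    using nrm_nonneg[of x] nrm_eq_0_iff[of x] by linarith
  moreover have "absv (a x) / nrm x \<le> dual_norm absv nrm a"
    unfolding dual_norm_def by (rule cSUP_upper[OF _ bdd_above_dual_norm[OF assms]]) simp
  ultimately show ?thesis
    by (simp add: divide_le_eq)
qed

lemma dual_norm_nonneg:
  assumes "a \<in> bounded_ops scale nrm (*) absv"
  shows "0 \<le> dual_norm absv nrm a"
  using cSUP_upper[OF _ bdd_above_dual_norm[OF assms], of 0] by (simp add: dual_norm_def)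

lemma dual_norm_le:
  assumes "0 \<le> C" "\<And>x. absv (a x) \<le> C * nrm x"
  shows "dual_norm absv nrm a \<le> C"
  unfolding dual_norm_def
proof (rule cSUP_least)
  show "absv (a x) / nrm x \<le> C" for x
    using assms(2)[of x] assms(1) nrm_nonneg[of x] by (cases "nrm x = 0") (auto simp: divide_le_eq)
qed simp

section \<open>Orthogonal bases of finite-dimensional subspaces\<close>

text \<open>
  There is no inner product: orthogonality means that a linear combination is at least as large as
  each of its terms. By the ultrametric inequality its norm is then the maximum of the norms of the
  terms.
\<close>

definition na_orthogonal :: "'e set \<Rightarrow> bool" where
  "na_orthogonal E \<longleftrightarrow> finite E \<and> 0 \<notin> E \<and>
    (\<forall>c. \<forall>e\<in>E. absv (c e) * nrm e \<le> nrm (\<Sum>u\<in>E. scale (c u) u))"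

lemma na_orthogonalD:
  "na_orthogonal E \<Longrightarrow> e \<in> E \<Longrightarrow> absv (c e) * nrm e \<le> nrm (\<Sum>u\<in>E. scale (c u) u)"
  by (simp add: na_orthogonal_def)

lemma nrm_pos: "x \<noteq> 0 \<Longrightarrow> 0 < nrm x"
  using nrm_nonneg[of x] nrm_eq_0_iff[of x] by linarith

lemma na_orthogonal_nrm_pos: "na_orthogonal E \<Longrightarrow> e \<in> E \<Longrightarrow> 0 < nrm e"
  by (auto simp: na_orthogonal_def intro: nrm_pos)

lemma na_orthogonal_independent:
  assumes "na_orthogonal E"
  shows "independent E"
proof -
  have "finite E"
    using assms by (simp add: na_orthogonal_def)
  moreover have "c e = 0" if "(\<Sum>u\<in>E. scale (c u) u) = 0" "e \<in> E" for c e
  proof -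
    have "absv (c e) * nrm e \<le> 0"
      using na_orthogonalD[OF assms that(2), of c] that(1) by simp
    then have "absv (c e) \<le> 0"
      using na_orthogonal_nrm_pos[OF assms that(2)] by (simp add: mult_le_0_iff)
    then show ?thesis
      using absv_nonneg[of "c e"] absv_eq_0_iff[of "c e"] by simp
  qed
  ultimately show ?thesis
    by (auto simp: dependent_finite)
qed

text \<open>
  The coordinates of a minimizing sequence in the span of \<open>E\<close> satisfy \<open>\<bar>c\<^sub>l - c\<^sub>k\<bar> \<parallel>e\<parallel> \<le> \<rho>\<^sub>k\<close> for \<open>k \<le> l\<close>,
  where \<open>\<rho>\<^sub>k\<close> decreases to the distance. The sequence need not converge, but for each
  \<open>e\<close> the balls around \<open>c\<^sub>k\<close> with radius \<open>\<rho>\<^sub>k / \<parallel>e\<parallel>\<close> are nested. Points in their intersections are the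
  coordinates of a vector at distance at most \<open>\<rho>\<^sub>k\<close> from \<open>y\<close>, for every \<open>k\<close>.
\<close>

lemma exists_best_approximation:
  assumes sc: "spherically_complete absv" and E: "na_orthogonal E"
  shows "\<exists>w\<in>span E. \<forall>u\<in>span E. nrm (y - w) \<le> nrm (y - u)"
proof -
  interpret fld: na_normed_space absv "(*)" absv
    by (rule field_normed_space)
  have fin: "finite E"
    using E by (simp add: na_orthogonal_def)
  define d where "d = Inf ((\<lambda>u. nrm (y - u)) ` span E)"
  have bdd: "bdd_below ((\<lambda>u. nrm (y - u)) ` span E)"
    by (rule bdd_belowI[of _ 0]) (auto simp: nrm_nonneg)
  have d0: "0 \<le> d"
    unfolding d_def using span_zero by (intro cInf_greatest) (auto simp: nrm_nonneg)
  define \<rho> where "\<rho> k = d + 1 / real (Suc k)" for k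
  have \<rho>_pos: "0 < \<rho> k" for k
    unfolding \<rho>_def using d0 by (simp add: add_nonneg_pos)
  have \<rho>_mono: "\<rho> l \<le> \<rho> k" if "k \<le> l" for k l
    unfolding \<rho>_def using that by (simp add: frac_le)
  have "\<exists>c. nrm (y - (\<Sum>e\<in>E. scale (c e) e)) \<le> \<rho> k" for k
  proof -
    have "Inf ((\<lambda>u. nrm (y - u)) ` span E) < \<rho> k"
      unfolding \<rho>_def d_def by simp
    then obtain u where "u \<in> span E" "nrm (y - u) < \<rho> k"
      using cInf_lessD[of "(\<lambda>u. nrm (y - u)) ` span E"] span_zero by blast
    then show ?thesis
      unfolding span_finite[OF fin] by (auto intro: less_imp_le)
  qed
  then obtain c where c: "\<And>k. nrm (y - (\<Sum>e\<in>E. scale (c k e) e)) \<le> \<rho> k"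
    by metis
  have c_diff: "absv (c l e - c k e) \<le> \<rho> k / nrm e" if "k \<le> l" "e \<in> E" for k l e
  proof -
    have "absv (c l e - c k e) * nrm e \<le> nrm (\<Sum>e\<in>E. scale (c l e - c k e) e)"
      using na_orthogonalD[OF E that(2), of "\<lambda>e. c l e - c k e"] .
    also have "(\<Sum>e\<in>E. scale (c l e - c k e) e)
        = (y - (\<Sum>e\<in>E. scale (c k e) e)) - (y - (\<Sum>e\<in>E. scale (c l e) e))"
      by (simp add: scale_left_diff_distrib sum_subtractf)
    also have "nrm \<dots> \<le> \<rho> k"
      using nrm_diff_le c[of k] c[of l] \<rho>_mono[OF that(1)]
      by (meson max.boundedI order_trans)
    finally show ?thesis
      using na_orthogonal_nrm_pos[OF E that(2)] by (simp add: field_simps)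
  qed
  have "\<exists>b. \<forall>k. absv (b - c k e) \<le> \<rho> k / nrm e" if e: "e \<in> E" for e
  proof -
    have pos: "0 \<le> \<rho> k / nrm e" for k
      using \<rho>_pos[of k] nrm_nonneg[of e] by simp
    have "decseq (\<lambda>k. {x. absv (x - c k e) \<le> \<rho> k / nrm e})"
    proof (intro decseq_SucI subsetI CollectI)
      fix k x
      assume "x \<in> {x. absv (x - c (Suc k) e) \<le> \<rho> (Suc k) / nrm e}"
      moreover have "\<rho> (Suc k) / nrm e \<le> \<rho> k / nrm e"
        using \<rho>_mono[of k "Suc k"] nrm_nonneg[of e] by (simp add: divide_right_mono)
      ultimately show "absv (x - c k e) \<le> \<rho> k / nrm e"
        using fld.nrm_triangle_le[of x "c k e" "c (Suc k) e"] c_diff[of k "Suc k", OF _ e] by simp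
    qed
    then have "(\<Inter>k. {x. absv (x - c k e) \<le> \<rho> k / nrm e}) \<noteq> {}"
      using sc[unfolded spherically_complete_def, rule_format,
          of "\<lambda>k. \<rho> k / nrm e" "\<lambda>k. c k e"] pos
      by (simp add: fld.mcball_norm_dist)
    then show ?thesis
      by blast
  qed
  then obtain b where b: "\<And>e k. e \<in> E \<Longrightarrow> absv (b e - c k e) \<le> \<rho> k / nrm e"
    by metis
  define w where "w = (\<Sum>e\<in>E. scale (b e) e)"
  have w_le: "nrm (y - w) \<le> \<rho> k" for k
  proof -
    have "nrm ((\<Sum>e\<in>E. scale (c k e) e) - w) = nrm (\<Sum>e\<in>E. scale (b e - c k e) e)"
      by (subst nrm_minus_commute) (simp add: w_def scale_left_diff_distrib sum_subtractf)
    also have "\<dots> \<le> \<rho> k"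
    proof (rule nrm_sum_le)
      show "0 \<le> \<rho> k"
        using \<rho>_pos[of k] by simp
      show "nrm (scale (b e - c k e) e) \<le> \<rho> k" if "e \<in> E" for e
        using b[OF that, of k] na_orthogonal_nrm_pos[OF E that] by (simp only: nrm_scale pos_le_divide_eq)
    qed
    finally show ?thesis
      using nrm_triangle_le[of y w "\<Sum>e\<in>E. scale (c k e) e"] c[of k] by simp
  qed
  have "nrm (y - w) \<le> d"
  proof (rule field_le_epsilon)
    fix \<epsilon> :: real
    assume "0 < \<epsilon>"
    then obtain k where "1 / real (Suc k) < \<epsilon>"
      by (auto simp: inverse_eq_divide dest: reals_Archimedean)
    then show "nrm (y - w) \<le> d + \<epsilon>"
      using w_le[of k] by (simp add: \<rho>_def)
  qed
  moreover have "d \<le> nrm (y - u)" if "u \<in> span E" for u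
    unfolding d_def using that by (intro cInf_lower bdd) auto
  moreover have "w \<in> span E"
    unfolding w_def by (intro span_sum span_scale span_base)
  ultimately show ?thesis
    by (meson order_trans)
qed

text \<open>
  If \<open>0\<close> is a best approximation to \<open>e\<close> in the span, then \<open>c e + X\<close> with \<open>X\<close> in the span is at least
  as large as \<open>c e\<close>. Hence it is also at least as large as \<open>X\<close>, which is the difference of the two.
\<close>

lemma na_orthogonal_insert:
  assumes E: "na_orthogonal E" and "e \<notin> span E" and min: "\<And>u. u \<in> span E \<Longrightarrow> nrm e \<le> nrm (e - u)"
  shows "na_orthogonal (insert e E)"
proof -
  have fin: "finite E" "e \<notin> E" "e \<noteq> 0"
    using E \<open>e \<notin> span E\<close> span_base span_zero by (auto simp: na_orthogonal_def)
  have "absv (c f) * nrm f \<le> nrm (\<Sum>u\<in>insert e E. scale (c u) u)" if f: "f \<in> insert e E" for c f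
  proof -
    define X where "X = (\<Sum>u\<in>E. scale (c u) u)"
    have X: "X \<in> span E"
      unfolding X_def by (intro span_sum span_scale span_base)
    have total: "(\<Sum>u\<in>insert e E. scale (c u) u) = scale (c e) e + X"
      using fin by (simp add: X_def)
    have first: "absv (c e) * nrm e \<le> nrm (scale (c e) e + X)"
    proof (cases "c e = 0")
      case True
      then show ?thesis
        by (simp add: nrm_nonneg absv_eq_0_iff[THEN iffD2])
    next
      case False
      define u where "u = scale (- (1 / c e)) X"
      have "scale (c e) e + X = scale (c e) (e - u)"
        using False by (simp add: u_def scale_right_distrib)
      moreover have "nrm e \<le> nrm (e - u)"
        using X by (intro min) (simp add: u_def span_scale span_neg)
      ultimately show ?thesis
        by (simp add: nrm_scale absv_nonneg mult_left_mono)
    qed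
    moreover have "absv (c f) * nrm f \<le> nrm (scale (c e) e + X)" if "f \<in> E"
    proof -
      have "absv (c f) * nrm f \<le> nrm X"
        unfolding X_def by (rule na_orthogonalD[OF E that])
      also have "\<dots> \<le> max (nrm (scale (c e) e + X)) (nrm (scale (c e) e))"
        using nrm_diff_le[of "scale (c e) e + X" "scale (c e) e"] by simp
      also have "\<dots> = nrm (scale (c e) e + X)"
        using first by (simp add: nrm_scale)
      finally show ?thesis .
    qed
    ultimately show ?thesis
      using f total by auto
  qed
  then show ?thesis
    using fin E by (auto simp: na_orthogonal_def)
qed

text \<open>Gram--Schmidt, with a best approximation in the role of the orthogonal projection.\<close>

lemma exists_orthogonal_basis:
  assumes sc: "spherically_complete absv" and "finite Y"
  shows "\<exists>E. na_orthogonal E \<and> span E = span Y \<and> card E \<le> card Y"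
  using \<open>finite Y\<close>
proof (induction Y)
  case empty
  show ?case
    by (intro exI[of _ "{}"]) (simp add: na_orthogonal_def)
next
  case (insert y Y)
  then obtain E where E: "na_orthogonal E" "span E = span Y" "card E \<le> card Y"
    by blast
  have fin: "finite E"
    using E by (simp add: na_orthogonal_def)
  show ?case
  proof (cases "y \<in> span E")
    case True
    then have "span (insert y Y) = span E"
      using E(2) by (simp add: span_redundant)
    with E insert.hyps show ?thesis
      by (intro exI[of _ E]) auto
  next
    case False
    obtain w where w: "w \<in> span E" "\<And>u. u \<in> span E \<Longrightarrow> nrm (y - w) \<le> nrm (y - u)"
      using exists_best_approximation[OF sc E(1)] by blast
    have "na_orthogonal (insert (y - w) E)"
    proof (rule na_orthogonal_insert[OF E(1)])
      show "y - w \<notin> span E"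
        using False w(1) span_add[of "y - w" E w] by auto
      show "nrm (y - w) \<le> nrm (y - w - u)" if "u \<in> span E" for u
        using w(2)[of "w + u"] w(1) that by (simp add: span_add diff_diff_eq)
    qed
    moreover have "span (insert (y - w) E) = span (insert y Y)"
    proof -
      have "span (insert (y - w) E) = span (insert y E)"
        by (rule span_eq[THEN iffD2])
          (use w(1) span_add[of "y - w" "insert (y - w) E" w] span_mono[of E "insert (y - w) E"]
            span_mono[of E "insert y E"] in \<open>auto intro: span_base span_diff\<close>)
      also have "\<dots> = span (insert y Y)"
        using E(2) by (simp add: span_insert)
      finally show ?thesis .
    qed
    moreover have "card (insert (y - w) E) \<le> card (insert y Y)"
      using E(3) insert.hyps fin by (simp add: card_insert_if)
    ultimately show ?thesis
      by blast
  qed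
qed

section \<open>Operators of finite rank\<close>

definition rank_le :: "nat \<Rightarrow> ('e \<Rightarrow> 'e) \<Rightarrow> bool" where
  "rank_le n T \<longleftrightarrow> T \<in> bounded_ops scale nrm scale nrm \<and>
    (\<exists>Y. finite Y \<and> card Y \<le> n \<and> range T \<subseteq> span Y)"

lemma rank_le_bounded: "rank_le n T \<Longrightarrow> T \<in> bounded_ops scale nrm scale nrm"
  by (simp add: rank_le_def)

lemma rank_le_mono: "rank_le m T \<Longrightarrow> m \<le> n \<Longrightarrow> rank_le n T"
  unfolding rank_le_def by (meson order_trans)

lemma rank_le_zero: "rank_le 0 (\<lambda>x. 0)"
  unfolding rank_le_def by (auto simp: bounded_ops_zero intro!: exI[of _ "{}"])

lemma rank_le_add:
  assumes "rank_le m T" "rank_le n S"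
  shows "rank_le (m + n) (\<lambda>x. T x + S x)"
proof -
  obtain Y Z where "finite Y" "card Y \<le> m" "range T \<subseteq> span Y" "finite Z" "card Z \<le> n" "range S \<subseteq> span Z"
    using assms by (auto simp: rank_le_def)
  moreover from this have "T x + S x \<in> span (Y \<union> Z)" for x
    unfolding span_Un by blast
  moreover have "card (Y \<union> Z) \<le> card Y + card Z"
    by (rule card_Un_le)
  ultimately show ?thesis
    using assms unfolding rank_le_def
    by (intro conjI bounded_ops_add exI[of _ "Y \<union> Z"]) auto
qed

lemma rank_le_uminus:
  assumes "rank_le n T"
  shows "rank_le n (\<lambda>x. - T x)"
  using assms unfolding rank_le_def by (auto simp: image_subset_iff intro: bounded_ops_uminus span_neg)

lemma rank_le_diff:
  assumes "rank_le m T" "rank_le n S"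
  shows "rank_le (m + n) (\<lambda>x. T x - S x)"
  using rank_le_add[OF assms(1) rank_le_uminus[OF assms(2)]] by simp

lemma rank_le_compose_left:
  assumes "rank_le n T" "S \<in> bounded_ops scale nrm scale nrm"
  shows "rank_le n (T \<circ> S)"
  using assms unfolding rank_le_def by (auto simp: image_subset_iff intro: bounded_ops_compose)

lemma rank_le_compose_right:
  assumes T: "rank_le n T" and S: "S \<in> bounded_ops scale nrm scale nrm"
  shows "rank_le n (S \<circ> T)"
proof -
  obtain Y where Y: "finite Y" "card Y \<le> n" "range T \<subseteq> span Y"
    using T by (auto simp: rank_le_def)
  have "S ` span Y = span (S ` Y)"
    using Vector_Spaces.linear.axioms(3)[OF bounded_ops_linear[OF S]] by (simp add: module_hom.span_image)
  then have "range (S \<circ> T) \<subseteq> span (S ` Y)"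
    using Y(3) by auto
  moreover have "card (S ` Y) \<le> n"
    using card_image_le[OF Y(1), of S] Y(2) by linarith
  ultimately show ?thesis
    using Y(1) T S unfolding rank_le_def by (blast intro: bounded_ops_compose)
qed

lemma rank_le_sum_rank_one:
  assumes "finite I" "\<And>i. i \<in> I \<Longrightarrow> a i \<in> bounded_ops scale nrm (*) absv"
  shows "rank_le (card I) (\<lambda>x. \<Sum>i\<in>I. scale (a i x) (y i))"
  unfolding rank_le_def
proof (intro conjI exI[of _ "y ` I"])
  show "(\<lambda>x. \<Sum>i\<in>I. scale (a i x) (y i)) \<in> bounded_ops scale nrm scale nrm"
    using assms by (intro bounded_ops_sum bounded_ops_rank_one)
  show "range (\<lambda>x. \<Sum>i\<in>I. scale (a i x) (y i)) \<subseteq> span (y ` I)"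
    by (auto intro!: span_sum span_scale intro: span_base)
qed (use assms card_image_le in auto)

text \<open>
  The functionals are the coordinates of \<open>T x\<close> in an orthogonal basis of the range, hence
  \<open>\<bar>g\<^sub>j x\<bar> \<parallel>e\<^sub>j\<parallel> \<le> \<parallel>T x\<parallel>\<close>. The basis may have fewer than \<open>n\<close> elements; it is padded with zeros, so that the
  number of terms is \<open>n\<close>.
\<close>

lemma finite_rank_representation:
  assumes sc: "spherically_complete absv" and T: "rank_le n T"
    and "0 \<le> \<delta>" and bd: "\<And>x. nrm (T x) \<le> \<delta> * nrm x"
  shows "\<exists>g e. (\<forall>j. g j \<in> bounded_ops scale nrm (*) absv \<and> dual_norm absv nrm (g j) * nrm (e j) \<le> \<delta>) \<and>
    (\<forall>j\<ge>n. e j = 0) \<and> (\<forall>x. T x = (\<Sum>j<n. scale (g j x) (e j)))"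
proof -
  interpret fld: na_normed_space absv "(*)" absv
    by (rule field_normed_space)
  obtain Y where Y: "finite Y" "card Y \<le> n" "range T \<subseteq> span Y"
    using T by (auto simp: rank_le_def)
  obtain E where E: "na_orthogonal E" "span E = span Y" "card E \<le> n"
    using exists_orthogonal_basis[OF sc Y(1)] Y(2) by (meson order_trans)
  have fin: "finite E" and ind: "independent E"
    using E na_orthogonal_independent by (auto simp: na_orthogonal_def)
  have TE: "T x \<in> span E" for x
    using E(2) Y(3) by auto
  have T_eq: "(\<Sum>u\<in>E. scale (representation E (T x) u) u) = T x" for x
    by (rule sum_representation_eq[OF ind TE fin]) simp
  have lin: "Vector_Spaces.linear scale scale T"
    using T by (simp add: rank_le_def bounded_ops_def)
  have coord_le: "absv (representation E (T x) u) \<le> \<delta> / nrm u * nrm x" if "u \<in> E" for u x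
  proof -
    have "absv (representation E (T x) u) * nrm u \<le> \<delta> * nrm x"
      using na_orthogonalD[OF E(1) that, of "representation E (T x)"] bd[of x] by (simp add: T_eq)
    moreover have "0 < nrm u"
      by (rule na_orthogonal_nrm_pos[OF E(1) that])
    ultimately show ?thesis
      by (simp add: field_simps)
  qed
  have coord: "(\<lambda>x. representation E (T x) u) \<in> bounded_ops scale nrm (*) absv" if "u \<in> E" for u
  proof (rule bounded_opsI)
    show "absv (representation E (T x) u) \<le> \<delta> / nrm u * nrm x" for x
      by (rule coord_le[OF that])
    show "Vector_Spaces.linear scale (*) (\<lambda>x. representation E (T x) u)"
      using lin unfolding Vector_Spaces.linear_iff
      by (auto simp: representation_add[OF ind TE TE] representation_scale[OF ind TE]
          na_normed_space.axioms(2)[OF field_normed_space])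
  qed
  have zero: "(\<lambda>x. 0) \<in> bounded_ops scale nrm (*) absv"
    by (rule bounded_opsI[where C = 0])
       (auto simp: Vector_Spaces.linear_iff vector_space_axioms na_normed_space.axioms(2)[OF field_normed_space])
  obtain h where h: "bij_betw h {0..<card E} E"
    using ex_bij_betw_nat_finite[OF fin] by blast
  define g where "g j = (if j < card E then (\<lambda>x. representation E (T x) (h j)) else (\<lambda>x. 0))" for j
  define e where "e j = (if j < card E then h j else 0)" for j
  have hE: "h j \<in> E" if "j < card E" for j
    using h that by (auto simp: bij_betw_def)
  have "g j \<in> bounded_ops scale nrm (*) absv" for j
    using hE coord zero by (simp add: g_def)
  moreover have "dual_norm absv nrm (g j) * nrm (e j) \<le> \<delta>" for j
  proof (cases "j < card E")
    case True
    have pos: "0 < nrm (h j)"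
      by (rule na_orthogonal_nrm_pos[OF E(1) hE[OF True]])
    have "dual_norm absv nrm (g j) \<le> \<delta> / nrm (h j)"
      using True coord_le[OF hE[OF True]] \<open>0 \<le> \<delta>\<close> pos by (intro dual_norm_le) (auto simp: g_def)
    then show ?thesis
      using True pos by (simp add: e_def field_simps)
  qed (use \<open>0 \<le> \<delta>\<close> in \<open>simp add: e_def\<close>)
  moreover have "T x = (\<Sum>j<n. scale (g j x) (e j))" for x
  proof -
    have "(\<Sum>j<n. scale (g j x) (e j)) = (\<Sum>j\<in>{0..<card E}. scale (g j x) (e j))"
      using E(3) by (intro sum.mono_neutral_right) (auto simp: e_def)
    also have "\<dots> = (\<Sum>j\<in>{0..<card E}. scale (representation E (T x) (h j)) (h j))"
      by (intro sum.cong) (auto simp: g_def e_def)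
    also have "\<dots> = T x"
      using sum.reindex_bij_betw[OF h, of "\<lambda>u. scale (representation E (T x) u) u"] T_eq by simp
    finally show ?thesis
      by simp
  qed
  moreover have "e j = 0" if "n \<le> j" for j
    using E(3) that by (simp add: e_def)
  ultimately show ?thesis
    by blast
qed

section \<open>Approximation by operators of finite rank\<close>

lemma L_op_ennreal_iff:
  assumes "nontrivial_valuation absv" and "0 < p"
  shows "A \<in> L_op (ennreal p) absv scale nrm scale nrm \<longleftrightarrow>
    A \<in> bounded_ops scale nrm scale nrm \<and>
    (\<exists>a y. (\<forall>n. a n \<in> bounded_ops scale nrm (*) absv) \<and>
      (\<forall>x. (\<lambda>N. nrm ((\<Sum>n<N. scale (a n x) (y n)) - A x)) \<longlonglongrightarrow> 0) \<and>
      summable (\<lambda>n. dual_norm absv nrm (a n) powr p * nrm (y n) powr p))"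
  using assms(2)
  unfolding L_op_def limitin_norm_topology_iff dual_space_eq_bounded[OF assms(1)]
  by (simp add: less_imp_le)

lemma L_op_ennrealI:
  assumes "nontrivial_valuation absv" "0 < p" "A \<in> bounded_ops scale nrm scale nrm"
    and "\<And>n. a n \<in> bounded_ops scale nrm (*) absv"
    and "\<And>x. (\<lambda>N. nrm ((\<Sum>n<N. scale (a n x) (y n)) - A x)) \<longlonglongrightarrow> 0"
    and "summable (\<lambda>n. dual_norm absv nrm (a n) powr p * nrm (y n) powr p)"
  shows "A \<in> L_op (ennreal p) absv scale nrm scale nrm"
  unfolding L_op_ennreal_iff[OF assms(1,2)] using assms(3-6) by blast

text \<open>
  Each block \<open>G\<^sub>k\<close> is expanded into \<open>N\<^sub>k\<close> rank-one terms of norm at most \<open>\<delta>\<^sub>k\<close>, and the double family of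
  terms is enumerated by the pairing function. The order is irrelevant for convergence: a partial
  sum that contains the terms of the first \<open>K\<close> blocks differs from the sum of these blocks by nonzero
  terms of later blocks only, and the norm of any finite sum of those is at most the
  largest \<open>\<delta>\<^sub>k \<parallel>x\<parallel>\<close> with \<open>k \<ge> K\<close>.
\<close>

lemma L_op_of_block_series:
  assumes nt: "nontrivial_valuation absv" and sc: "spherically_complete absv" and v: "0 < v"
    and A: "A \<in> bounded_ops scale nrm scale nrm"
    and rank: "\<And>k. rank_le (N k) (G k)"
    and \<delta>: "\<And>k. 0 \<le> \<delta> k" and bd: "\<And>k x. nrm (G k x) \<le> \<delta> k * nrm x"
    and lim_\<delta>: "\<delta> \<longlonglongrightarrow> 0" and sum_\<delta>: "summable (\<lambda>k. real (N k) * \<delta> k powr v)"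
    and conv: "\<And>x. (\<lambda>K. nrm ((\<Sum>k<K. G k x) - A x)) \<longlonglongrightarrow> 0"
  shows "A \<in> L_op (ennreal v) absv scale nrm scale nrm"
proof -
  have "\<forall>k. \<exists>g e. (\<forall>j. g j \<in> bounded_ops scale nrm (*) absv \<and> dual_norm absv nrm (g j) * nrm (e j) \<le> \<delta> k) \<and>
    (\<forall>j\<ge>N k. e j = 0) \<and> (\<forall>x. G k x = (\<Sum>j<N k. scale (g j x) (e j)))"
    (is "\<forall>k. \<exists>g e. ?P k g e")
  proof
    fix k
    show "\<exists>g e. ?P k g e"
      by (rule finite_rank_representation[where T = "G k" and n = "N k" and \<delta> = "\<delta> k", OF sc rank \<delta> bd])
  qed
  from choice[OF this] obtain g where "\<forall>k. \<exists>e. ?P k (g k) e"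
    by (elim exE)
  from choice[OF this] obtain e where "\<forall>k. ?P k (g k) (e k)"
    by (elim exE)
  then have ge: "\<And>k j. g k j \<in> bounded_ops scale nrm (*) absv"
    "\<And>k j. dual_norm absv nrm (g k j) * nrm (e k j) \<le> \<delta> k"
    "\<And>k j. N k \<le> j \<Longrightarrow> e k j = 0"
    "\<And>k x. G k x = (\<Sum>j<N k. scale (g k j x) (e k j))"
    by simp_all
  define a where "a i = (case prod_decode i of (k, j) \<Rightarrow> g k j)" for i
  define y where "y i = (case prod_decode i of (k, j) \<Rightarrow> e k j)" for i
  \<comment> \<open>\<open>P M\<close> holds the index pairs of the first \<open>M\<close> terms, \<open>B K\<close> those of the first \<open>K\<close> blocks without padding.\<close>
  define P where "P M = prod_decode ` {..<M}" for M
  define B where "B K = (SIGMA k:{..<K}. {..<N k})" for K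
  have fin: "finite (P M)" "finite (B K)" for M K
    by (auto simp: P_def B_def)
  have inj: "inj_on prod_decode X" for X
    by (rule inj_prod_decode)
  define W where "W = (\<lambda>(k, j). dual_norm absv nrm (g k j) powr v * nrm (e k j) powr v)"
  have W_nonneg: "0 \<le> W p" for p
    by (simp add: W_def case_prod_beta)
  have W_le: "W (k, j) \<le> \<delta> k powr v" for k j
  proof -
    have "W (k, j) = (dual_norm absv nrm (g k j) * nrm (e k j)) powr v"
      using dual_norm_nonneg[OF ge(1), of k j] nrm_nonneg[of "e k j"] by (simp add: W_def powr_mult)
    also have "\<dots> \<le> \<delta> k powr v"
      using ge(2)[of k j] dual_norm_nonneg[OF ge(1), of k j] nrm_nonneg[of "e k j"] v
      by (intro powr_mono2) auto
    finally show ?thesis .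
  qed
  have W_zero: "W (k, j) = 0" if "N k \<le> j" for k j
    using ge(3)[OF that] by (simp add: W_def)
  have "summable (\<lambda>i. W (prod_decode i))"
  proof (rule summableI_nonneg_bounded)
    fix M
    have "(\<Sum>i<M. W (prod_decode i)) = sum W (P M)"
      unfolding P_def by (subst sum.reindex[OF inj]) (simp add: o_def)
    also have "\<dots> = sum W (P M \<inter> B M)"
    proof (rule sum.mono_neutral_right)
      show "\<forall>p\<in>P M - P M \<inter> B M. W p = 0"
      proof
        fix p
        assume p: "p \<in> P M - P M \<inter> B M"
        obtain k j where kj: "p = (k, j)"
          by fastforce
        with p obtain i where "i < M" "prod_decode i = (k, j)"
          by (auto simp: P_def)
        then have "k < M"
          using le_prod_encode_1[of k j] prod_decode_inverse[of i] by simp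
        then show "W p = 0"
          using p kj by (auto simp: B_def intro!: W_zero)
      qed
    qed (auto simp: fin)
    also have "\<dots> \<le> sum W (B M)"
      by (rule sum_mono2) (auto simp: fin W_nonneg)
    also have "\<dots> = (\<Sum>k<M. \<Sum>j<N k. W (k, j))"
      unfolding B_def by (subst sum.Sigma) auto
    also have "\<dots> \<le> (\<Sum>k<M. real (N k) * \<delta> k powr v)"
    proof (rule sum_mono)
      show "(\<Sum>j<N k. W (k, j)) \<le> real (N k) * \<delta> k powr v" for k
        using sum_bounded_above[of "{..<N k}" "\<lambda>j. W (k, j)" "\<delta> k powr v"] W_le by simp
    qed
    also have "\<dots> \<le> (\<Sum>k. real (N k) * \<delta> k powr v)"
      by (rule sum_le_suminf[OF sum_\<delta>]) auto
    finally show "(\<Sum>i<M. W (prod_decode i)) \<le> (\<Sum>k. real (N k) * \<delta> k powr v)" .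
  qed (rule W_nonneg)
  moreover have "(\<lambda>M. nrm ((\<Sum>i<M. scale (a i x) (y i)) - A x)) \<longlonglongrightarrow> 0" for x
  proof -
    define t where "t = (\<lambda>(k, j). scale (g k j x) (e k j))"
    have t_le: "nrm (t (k, j)) \<le> \<delta> k * nrm x" for k j
    proof -
      have "nrm (t (k, j)) \<le> dual_norm absv nrm (g k j) * nrm x * nrm (e k j)"
        using mult_right_mono[OF absv_le_dual_norm[OF ge(1), of k j x] nrm_nonneg[of "e k j"]]
        by (simp add: t_def nrm_scale)
      also have "\<dots> \<le> \<delta> k * nrm x"
        using mult_right_mono[OF ge(2)[of k j] nrm_nonneg[of x]] by (simp add: mult_ac)
      finally show ?thesis .
    qed
    have t_zero: "t (k, j) = 0" if "N k \<le> j" for k j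
      using ge(3)[OF that] by (simp add: t_def)
    have partial: "(\<Sum>i<M. scale (a i x) (y i)) = sum t (P M)" for M
      unfolding P_def by (subst sum.reindex[OF inj]) (simp add: o_def t_def a_def y_def case_prod_beta)
    show ?thesis
      unfolding partial
    proof (rule LIMSEQ_I)
      fix \<epsilon> :: real
      assume \<epsilon>: "0 < \<epsilon>"
      have "(\<lambda>k. \<delta> k * nrm x) \<longlonglongrightarrow> 0"
        using tendsto_mult_right[OF lim_\<delta>, of "nrm x"] by simp
      then have "\<forall>\<^sub>F k in sequentially. \<delta> k * nrm x < \<epsilon> / 2"
        using \<epsilon> by (intro order_tendstoD) auto
      then have "\<forall>\<^sub>F K in sequentially. \<forall>k\<ge>K. \<delta> k * nrm x < \<epsilon> / 2"
        by (rule eventually_all_ge_at_top)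
      moreover have "\<forall>\<^sub>F K in sequentially. nrm ((\<Sum>k<K. G k x) - A x) < \<epsilon> / 2"
        using \<epsilon> by (intro order_tendstoD(2)[OF conv]) auto
      ultimately have "\<forall>\<^sub>F K in sequentially. (\<forall>k\<ge>K. \<delta> k * nrm x < \<epsilon> / 2) \<and>
          nrm ((\<Sum>k<K. G k x) - A x) < \<epsilon> / 2"
        by (rule eventually_conj)
      then obtain K where K: "\<And>k. K \<le> k \<Longrightarrow> \<delta> k * nrm x < \<epsilon> / 2"
          "nrm ((\<Sum>k<K. G k x) - A x) < \<epsilon> / 2"
        using eventually_happens'[OF sequentially_bot] by fast
      have "(\<Sum>k<K. G k x) = (\<Sum>k<K. \<Sum>j<N k. t (k, j))"
        by (simp add: ge(4) t_def)
      also have "\<dots> = sum t (B K)"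
        unfolding B_def by (subst sum.Sigma) auto
      finally have B_sum: "sum t (B K) = (\<Sum>k<K. G k x)"
        by simp
      obtain M\<^sub>0 where M0: "prod_encode ` B K \<subseteq> {..<M\<^sub>0}"
        using finite_nat_bounded[of "prod_encode ` B K"] fin by auto
      have "nrm (sum t (P M) - A x) < \<epsilon>" if M: "M\<^sub>0 \<le> M" for M
      proof -
        have sub: "B K \<subseteq> P M"
        proof
          fix p
          assume "p \<in> B K"
          then have "prod_encode p < M"
            using M0 M by auto
          then show "p \<in> P M"
            unfolding P_def by (metis imageI lessThan_iff prod_encode_inverse)
        qed
        have "nrm (sum t (P M - B K)) \<le> \<epsilon> / 2"
        proof (rule nrm_sum_le)
          fix p
          assume "p \<in> P M - B K"
          moreover obtain k j where kj: "p = (k, j)"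
            by fastforce
          ultimately have "K \<le> k \<or> N k \<le> j"
            by (auto simp: B_def)
          then show "nrm (t p) \<le> \<epsilon> / 2"
            using K(1)[of k] t_le[of k j] t_zero[of k j] kj \<epsilon> by force
        qed (use \<epsilon> in simp)
        moreover have split: "sum t (P M) - A x = sum t (P M - B K) + ((\<Sum>k<K. G k x) - A x)"
          using sum.subset_diff[OF sub fin(1), of t] by (simp add: B_sum)
        ultimately show ?thesis
          using nrm_add_le[of "sum t (P M - B K)" "(\<Sum>k<K. G k x) - A x"] K(2) \<epsilon>
          unfolding split by linarith
      qed
      then show "\<exists>M\<^sub>0. \<forall>M\<ge>M\<^sub>0. norm (nrm (sum t (P M) - A x) - 0) < \<epsilon>"
        using nrm_nonneg by auto
    qed
  qed
  ultimately show ?thesis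
    by (intro L_op_ennrealI[OF nt v A, where a = a and y = y]) (simp_all add: a_def y_def ge(1) W_def case_prod_beta)
qed

text \<open>
  The telescoping blocks \<open>G\<^sub>k = H\<^sub>k\<^sub>+\<^sub>1 - H\<^sub>k\<close> of the dyadic approximations sum up to \<open>A\<close>. The rank of a
  block is \<open>O(2\<^sup>k)\<close> and its norm is controlled by the error at its lower end, so the required
  summability is that of \<open>\<Sum> 2\<^sup>k c(2\<^sup>k)\<^sup>v\<close>.
\<close>

lemma L_op_of_approximation:
  assumes nt: "nontrivial_valuation absv" and sc: "spherically_complete absv" and v: "0 < v"
    and A: "A \<in> bounded_ops scale nrm scale nrm"
    and F: "\<And>n. rank_le (m * n) (F n)" "\<And>n x. nrm (A x - F n x) \<le> c n * nrm x"
    and c: "\<And>n. 0 \<le> c n" "decseq c" "summable (\<lambda>n. c n powr v)"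
  shows "A \<in> L_op (ennreal v) absv scale nrm scale nrm"
proof -
  have c_lim: "c \<longlonglongrightarrow> 0"
    by (rule tendsto_zero_if_summable_powr[OF v c(1,3)])
  obtain C where C: "0 \<le> C" "\<And>x. nrm (F 1 x) \<le> C * nrm x"
    using bounded_opsE[OF rank_le_bounded[OF F(1)[of 1]]] by metis
  \<comment> \<open>\<open>H\<close> starts with the zero operator, so that the blocks sum up to \<open>H\<close> itself; the first
      block \<open>F 1\<close> is only bounded by some constant \<open>C\<close>.\<close>
  define H where "H k = (if k = 0 then (\<lambda>x. 0) else F (2 ^ (k - 1)))" for k :: nat
  define G where "G k x = H (Suc k) x - H k x" for k x
  define \<delta> where "\<delta> k = (if k = 0 then C else c (2 ^ (k - 1)))" for k :: nat
  have H: "rank_le (m * 2 ^ k) (H k)" for k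
  proof (cases k)
    case 0
    then show ?thesis
      using rank_le_mono[OF rank_le_zero] by (simp add: H_def)
  next
    case (Suc k')
    then show ?thesis
      using rank_le_mono[OF F(1)[of "2 ^ k'"], of "m * 2 ^ k"] by (simp add: H_def)
  qed
  have pow_lim: "(\<lambda>k. c (2 ^ k)) \<longlonglongrightarrow> 0"
    using LIMSEQ_subseq_LIMSEQ[OF c_lim, of "\<lambda>k. 2 ^ k"] by (simp add: o_def strict_mono_def)
  show ?thesis
  proof (rule L_op_of_block_series[OF nt sc v A, where G = G and \<delta> = \<delta> and N = "\<lambda>k. 3 * m * 2 ^ k"])
    show "rank_le (3 * m * 2 ^ k) (G k)" for k
      using rank_le_diff[OF H[of "Suc k"] H[of k]] unfolding G_def by (simp add: algebra_simps)
    show "0 \<le> \<delta> k" for k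
      using C c(1) by (simp add: \<delta>_def)
    show "nrm (G k x) \<le> \<delta> k * nrm x" for k x
    proof (cases k)
      case 0
      then show ?thesis
        using C by (simp add: G_def H_def \<delta>_def)
    next
      case (Suc k')
      have "c (2 ^ Suc k') \<le> c (2 ^ k')"
        using c(2) by (simp add: decseq_def)
      then have "nrm (A x - F (2 ^ Suc k') x) \<le> c (2 ^ k') * nrm x"
        using F(2)[where x = x and n = "2 ^ Suc k'"] nrm_nonneg[of x] by (meson mult_right_mono order_trans)
      then show ?thesis
        using nrm_triangle_le[of "F (2 ^ Suc k') x" "F (2 ^ k') x" "A x"] F(2)[where x = x and n = "2 ^ k'"] Suc
        by (simp add: G_def H_def \<delta>_def nrm_minus_commute[of "F (2 * 2 ^ k') x" "A x"])
    qed
    show "\<delta> \<longlonglongrightarrow> 0"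
      using pow_lim by (subst filterlim_sequentially_Suc[symmetric]) (simp add: \<delta>_def)
    have "summable (\<lambda>k. 2 ^ k * c (2 ^ k) powr v)"
      using condensation_test[of "\<lambda>n. c n powr v"] c v
      by (simp add: powr_mono2 decseq_SucD less_imp_le)
    then have "summable (\<lambda>k. 6 * real m * (2 ^ k * c (2 ^ k) powr v))"
      by (rule summable_mult)
    then show "summable (\<lambda>k. real (3 * m * 2 ^ k) * \<delta> k powr v)"
      by (subst summable_Suc_iff[symmetric]) (simp add: \<delta>_def mult_ac)
    show "(\<lambda>K. nrm ((\<Sum>k<K. G k x) - A x)) \<longlonglongrightarrow> 0" for x
    proof -
      have "(\<Sum>k<K. G k x) = H K x" for K
        using sum_lessThan_telescope[of "\<lambda>k. H k x" K] by (simp add: G_def H_def)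
      moreover have "(\<lambda>k. nrm (F (2 ^ k) x - A x)) \<longlonglongrightarrow> 0"
      proof (rule tendsto_sandwich[OF _ _ tendsto_const])
        show "(\<lambda>k. c (2 ^ k) * nrm x) \<longlonglongrightarrow> 0"
          using tendsto_mult_right[OF pow_lim, of "nrm x"] by simp
        show "\<forall>\<^sub>F k in sequentially. nrm (F (2 ^ k) x - A x) \<le> c (2 ^ k) * nrm x"
          using F(2) by (simp add: nrm_minus_commute)
      qed (simp add: nrm_nonneg)
      ultimately show ?thesis
        by (subst filterlim_sequentially_Suc[symmetric]) (simp add: H_def)
    qed
  qed
qed

text \<open>
  \<open>F\<^sub>n\<close> keeps the \<open>n\<close> terms with the largest coefficients \<open>d\<^sub>i = \<parallel>a\<^sub>i\<parallel> \<parallel>y\<^sub>i\<parallel>\<close>. Every remaining term is bounded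
  by the next largest coefficient, hence so is the remaining sum.
\<close>

lemma L_op_approximation:
  assumes nt: "nontrivial_valuation absv" and q: "0 < q"
    and J: "J \<in> L_op (ennreal q) absv scale nrm scale nrm"
  shows "\<exists>c F. decseq c \<and> (\<forall>n. 0 \<le> c n) \<and> summable (\<lambda>n. c n powr q) \<and>
    (\<forall>n. rank_le n (F n)) \<and> (\<forall>n x. nrm (J x - F n x) \<le> c n * nrm x)"
proof -
  obtain a y where a: "\<And>n. a n \<in> bounded_ops scale nrm (*) absv"
    and lim: "\<And>x. (\<lambda>N. nrm ((\<Sum>n<N. scale (a n x) (y n)) - J x)) \<longlonglongrightarrow> 0"
    and sum: "summable (\<lambda>n. dual_norm absv nrm (a n) powr q * nrm (y n) powr q)"
    using J unfolding L_op_ennreal_iff[OF nt q] by blast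
  define d where "d n = dual_norm absv nrm (a n) * nrm (y n)" for n
  have d: "0 \<le> d n" for n
    by (simp add: d_def dual_norm_nonneg[OF a] nrm_nonneg)
  have sum_d: "summable (\<lambda>n. d n powr q)"
    using sum by (simp add: d_def powr_mult dual_norm_nonneg[OF a] nrm_nonneg)
  from decreasing_enumeration[OF d tendsto_zero_if_summable_powr[OF q d sum_d]]
  obtain \<sigma> :: "nat \<Rightarrow> nat" where "inj \<sigma> \<and> (\<forall>n i. i \<notin> \<sigma> ` {..<n} \<longrightarrow> d i \<le> d (\<sigma> n))"
    by (elim exE)
  note \<sigma> = conjunct1[OF this] conjunct2[OF this, rule_format]
  define F where "F = (\<lambda>n x. \<Sum>i\<in>\<sigma> ` {..<n}. scale (a i x) (y i))"
  have "decseq (\<lambda>n. d (\<sigma> n))"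
  proof (rule decseq_SucI)
    fix n
    have "\<sigma> (Suc n) \<notin> \<sigma> ` {..<n}"
      by (simp add: inj_image_mem_iff[OF \<sigma>(1)])
    then show "d (\<sigma> (Suc n)) \<le> d (\<sigma> n)"
      by (rule \<sigma>(2))
  qed
  moreover have "summable (\<lambda>n. d (\<sigma> n) powr q)"
    using summable_reindex[OF sum_d \<sigma>(1)] by (simp add: o_def)
  moreover have "rank_le n (F n)" for n
    using rank_le_sum_rank_one[of "\<sigma> ` {..<n}" a y] a card_image[of \<sigma> "{..<n}"] \<sigma>(1)
    by (simp add: F_def inj_on_subset)
  moreover have "nrm (J x - F n x) \<le> d (\<sigma> n) * nrm x" for n x
  proof (rule ccontr)
    \<comment> \<open>If the error were larger than the bound, it would exceed both the distance from \<open>J x\<close> to a late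
        partial sum and the terms of that partial sum that \<open>F n\<close> omits.\<close>
    assume "\<not> ?thesis"
    then have less: "d (\<sigma> n) * nrm x < nrm (J x - F n x)"
      by simp
    then have "0 < nrm (J x - F n x)"
      using d[of "\<sigma> n"] nrm_nonneg[of x] by (meson le_less_trans mult_nonneg_nonneg)
    then have "\<forall>\<^sub>F N in sequentially. nrm ((\<Sum>i<N. scale (a i x) (y i)) - J x) < nrm (J x - F n x)"
      by (rule order_tendstoD(2)[OF lim])
    then obtain N\<^sub>0 where N0: "\<And>N. N\<^sub>0 \<le> N \<Longrightarrow> nrm ((\<Sum>i<N. scale (a i x) (y i)) - J x) < nrm (J x - F n x)"
      by (auto simp: eventually_sequentially)
    obtain N\<^sub>1 where N1: "\<sigma> ` {..<n} \<subseteq> {..<N\<^sub>1}"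
      using finite_nat_bounded[of "\<sigma> ` {..<n}"] by auto
    define N where "N = max N\<^sub>0 N\<^sub>1"
    have sub: "\<sigma> ` {..<n} \<subseteq> {..<N}"
      using N1 by (auto simp: N_def)
    have "nrm (\<Sum>i\<in>{..<N} - \<sigma> ` {..<n}. scale (a i x) (y i)) \<le> d (\<sigma> n) * nrm x"
    proof (rule nrm_sum_le)
      fix i
      assume "i \<in> {..<N} - \<sigma> ` {..<n}"
      then have "d i * nrm x \<le> d (\<sigma> n) * nrm x"
        by (intro mult_right_mono \<sigma>(2)) (auto simp: nrm_nonneg)
      then show "nrm (scale (a i x) (y i)) \<le> d (\<sigma> n) * nrm x"
        using mult_right_mono[OF absv_le_dual_norm[OF a, of i x] nrm_nonneg[of "y i"]]
        by (simp add: nrm_scale d_def mult_ac)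
    qed (simp add: d nrm_nonneg)
    moreover have "(\<Sum>i\<in>{..<N} - \<sigma> ` {..<n}. scale (a i x) (y i)) = (\<Sum>i<N. scale (a i x) (y i)) - F n x"
      using sum.subset_diff[OF sub, of "\<lambda>i. scale (a i x) (y i)"] by (simp add: F_def)
    ultimately show False
      using nrm_triangle_le[of "J x" "F n x" "\<Sum>i<N. scale (a i x) (y i)"] N0[of N] less
      by (simp add: N_def nrm_minus_commute[of "J x"])
  qed
  ultimately show ?thesis
    using d by (intro exI[of _ "\<lambda>n. d (\<sigma> n)"] exI[of _ F]) auto
qed

section \<open>Compositions\<close>

lemma L_op_bounded:
  "A \<in> L_op p absv scale nrm scale nrm \<Longrightarrow> A \<in> bounded_ops scale nrm scale nrm"
  by (auto simp: L_op_def split: if_splits)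

text \<open>
  The approximation to \<open>J S\<close> is \<open>F\<^sub>n S + (J - F\<^sub>n) F'\<^sub>n\<close>: its rank is at most \<open>2 n\<close>, since each summand has a
  factor of rank at most \<open>n\<close>, and its error is the product \<open>(J - F\<^sub>n) (S - F'\<^sub>n)\<close>.
\<close>

lemma L_op_compose_finite:
  assumes nt: "nontrivial_valuation absv" and sc: "spherically_complete absv"
    and pos: "0 < q" "0 < r" "0 < v" and exps: "1 / q + 1 / r = 1 / v"
    and J: "J \<in> L_op (ennreal q) absv scale nrm scale nrm"
    and S: "S \<in> L_op (ennreal r) absv scale nrm scale nrm"
  shows "J \<circ> S \<in> L_op (ennreal v) absv scale nrm scale nrm"
proof -
  obtain c F where c: "decseq c" "\<And>n. 0 \<le> c n" "summable (\<lambda>n. c n powr q)"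
    and F: "\<And>n. rank_le n (F n)" "\<And>n x. nrm (J x - F n x) \<le> c n * nrm x"
    using L_op_approximation[OF nt pos(1) J] by blast
  obtain d F' where d: "decseq d" "\<And>n. 0 \<le> d n" "summable (\<lambda>n. d n powr r)"
    and F': "\<And>n. rank_le n (F' n)" "\<And>n x. nrm (S x - F' n x) \<le> d n * nrm x"
    using L_op_approximation[OF nt pos(2) S] by blast
  have R: "(\<lambda>x. J x - F n x) \<in> bounded_ops scale nrm scale nrm" for n
    by (rule bounded_ops_diff[OF L_op_bounded[OF J] rank_le_bounded[OF F(1)]])
  show ?thesis
  proof (rule L_op_of_approximation[OF nt sc pos(3), where m = 2
        and F = "\<lambda>n x. F n (S x) + (J (F' n x) - F n (F' n x))" and c = "\<lambda>n. c n * d n"])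
    show "J \<circ> S \<in> bounded_ops scale nrm scale nrm"
      by (rule bounded_ops_compose[OF L_op_bounded[OF J] L_op_bounded[OF S]])
    show "rank_le (2 * n) (\<lambda>x. F n (S x) + (J (F' n x) - F n (F' n x)))" for n
      using rank_le_add[OF rank_le_compose_left[OF F(1) L_op_bounded[OF S]] rank_le_compose_right[OF F'(1) R], of n n n]
      by (simp add: o_def mult_2)
    show "nrm ((J \<circ> S) x - (F n (S x) + (J (F' n x) - F n (F' n x)))) \<le> c n * d n * nrm x" for n x
    proof -
      have "J (S x - F' n x) - F n (S x - F' n x) = (J (S x) - F n (S x)) - (J (F' n x) - F n (F' n x))"
        using Vector_Spaces.linear.axioms(3)[OF bounded_ops_linear[OF R[of n]]]
        by (rule module_hom.diff)
      then have "nrm ((J \<circ> S) x - (F n (S x) + (J (F' n x) - F n (F' n x)))) \<le> c n * nrm (S x - F' n x)"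
        using F(2)[where n = n and x = "S x - F' n x"] by (simp add: diff_diff_eq)
      also have "\<dots> \<le> c n * (d n * nrm x)"
        by (intro mult_left_mono F'(2) c(2))
      finally show ?thesis
        by (simp add: mult.assoc)
    qed
    show "decseq (\<lambda>n. c n * d n)"
      using c(1,2) d(1,2) by (auto simp: decseq_def intro: mult_mono)
  qed (use c d pos exps in \<open>auto intro: summable_powr_mult\<close>)
qed

lemma L_op_compose_bounded_right:
  assumes nt: "nontrivial_valuation absv" and q: "0 < q"
    and J: "J \<in> L_op (ennreal q) absv scale nrm scale nrm"
    and S: "S \<in> bounded_ops scale nrm scale nrm"
  shows "J \<circ> S \<in> L_op (ennreal q) absv scale nrm scale nrm"
proof -
  obtain a y where a: "\<And>n. a n \<in> bounded_ops scale nrm (*) absv"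
    and lim: "\<And>x. (\<lambda>N. nrm ((\<Sum>n<N. scale (a n x) (y n)) - J x)) \<longlonglongrightarrow> 0"
    and sum: "summable (\<lambda>n. dual_norm absv nrm (a n) powr q * nrm (y n) powr q)"
    using J unfolding L_op_ennreal_iff[OF nt q] by blast
  obtain C where C: "0 \<le> C" "\<And>x. nrm (S x) \<le> C * nrm x"
    using bounded_opsE[OF S] by metis
  have aS: "a n \<circ> S \<in> bounded_ops scale nrm (*) absv" for n
    by (rule bounded_ops_compose[OF a S])
  have dn: "dual_norm absv nrm (a n \<circ> S) \<le> C * dual_norm absv nrm (a n)" for n
  proof (rule dual_norm_le)
    show "0 \<le> C * dual_norm absv nrm (a n)"
      by (simp add: C dual_norm_nonneg[OF a])
    show "absv ((a n \<circ> S) x) \<le> C * dual_norm absv nrm (a n) * nrm x" for x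
      using order_trans[OF absv_le_dual_norm[OF a, of n "S x"] mult_left_mono[OF C(2)[of x] dual_norm_nonneg[OF a[of n]]]]
      by (simp add: mult_ac)
  qed
  have "summable (\<lambda>n. dual_norm absv nrm (a n \<circ> S) powr q * nrm (y n) powr q)"
  proof (rule summable_comparison_test'[OF summable_mult[OF sum, of "C powr q"]])
    fix n
    have "dual_norm absv nrm (a n \<circ> S) powr q \<le> (C * dual_norm absv nrm (a n)) powr q"
      using q by (intro powr_mono2 dn) (auto simp: dual_norm_nonneg[OF aS])
    then show "norm (dual_norm absv nrm (a n \<circ> S) powr q * nrm (y n) powr q)
        \<le> C powr q * (dual_norm absv nrm (a n) powr q * nrm (y n) powr q)"
      using C(1) by (simp add: powr_mult dual_norm_nonneg[OF a] mult_right_mono flip: mult.assoc)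
  qed
  moreover have "J \<circ> S \<in> bounded_ops scale nrm scale nrm"
    by (rule bounded_ops_compose[OF L_op_bounded[OF J] S])
  ultimately show ?thesis
    using aS lim[of "S _"]
    by (intro L_op_ennrealI[OF nt q, where a = "\<lambda>n. a n \<circ> S" and y = y]) simp_all
qed

lemma L_op_compose_bounded_left:
  assumes nt: "nontrivial_valuation absv" and r: "0 < r"
    and J: "J \<in> bounded_ops scale nrm scale nrm"
    and S: "S \<in> L_op (ennreal r) absv scale nrm scale nrm"
  shows "J \<circ> S \<in> L_op (ennreal r) absv scale nrm scale nrm"
proof -
  obtain b z where b: "\<And>n. b n \<in> bounded_ops scale nrm (*) absv"
    and lim: "\<And>x. (\<lambda>N. nrm ((\<Sum>n<N. scale (b n x) (z n)) - S x)) \<longlonglongrightarrow> 0"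
    and sum: "summable (\<lambda>n. dual_norm absv nrm (b n) powr r * nrm (z n) powr r)"
    using S unfolding L_op_ennreal_iff[OF nt r] by blast
  obtain C where C: "0 \<le> C" "\<And>x. nrm (J x) \<le> C * nrm x"
    using bounded_opsE[OF J] by metis
  have hom: "module_hom scale scale J"
    using Vector_Spaces.linear.axioms(3)[OF bounded_ops_linear[OF J]] .
  have "summable (\<lambda>n. dual_norm absv nrm (b n) powr r * nrm (J (z n)) powr r)"
  proof (rule summable_comparison_test'[OF summable_mult[OF sum, of "C powr r"]])
    fix n
    have "nrm (J (z n)) powr r \<le> (C * nrm (z n)) powr r"
      using r by (intro powr_mono2 C) (auto simp: nrm_nonneg)
    then have "dual_norm absv nrm (b n) powr r * nrm (J (z n)) powr r
        \<le> dual_norm absv nrm (b n) powr r * (C * nrm (z n)) powr r"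
      by (rule mult_left_mono) simp
    then show "norm (dual_norm absv nrm (b n) powr r * nrm (J (z n)) powr r)
        \<le> C powr r * (dual_norm absv nrm (b n) powr r * nrm (z n) powr r)"
      using C(1) by (simp add: powr_mult nrm_nonneg mult_ac)
  qed
  moreover have "(\<lambda>N. nrm ((\<Sum>n<N. scale (b n x) (J (z n))) - J (S x))) \<longlonglongrightarrow> 0" for x
  proof (rule tendsto_sandwich[OF _ _ tendsto_const])
    show "(\<lambda>N. C * nrm ((\<Sum>n<N. scale (b n x) (z n)) - S x)) \<longlonglongrightarrow> 0"
      using tendsto_mult_left[OF lim, of C x] by simp
    have "(\<Sum>n<N. scale (b n x) (J (z n))) - J (S x) = J ((\<Sum>n<N. scale (b n x) (z n)) - S x)" for N
      by (simp add: module_hom.diff[OF hom] module_hom.sum[OF hom] module_hom.scale[OF hom])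
    then show "\<forall>\<^sub>F N in sequentially. nrm ((\<Sum>n<N. scale (b n x) (J (z n))) - J (S x))
        \<le> C * nrm ((\<Sum>n<N. scale (b n x) (z n)) - S x)"
      by (simp add: C)
  qed (simp add: nrm_nonneg)
  moreover have "J \<circ> S \<in> bounded_ops scale nrm scale nrm"
    by (rule bounded_ops_compose[OF J L_op_bounded[OF S]])
  ultimately show ?thesis
    using b by (intro L_op_ennrealI[OF nt r, where a = b and y = "\<lambda>n. J (z n)"]) simp_all
qed

end

theorem proposition2p11:
  fixes absv :: "'f::field \<Rightarrow> real"
    and scale :: "'f \<Rightarrow> 'h::ab_group_add \<Rightarrow> 'h"
    and nrm :: "'h \<Rightarrow> real"
    and q r v :: ennreal
    and J S :: "'h \<Rightarrow> 'h"
  assumes "na_valued_field absv"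
    and "nontrivial_valuation absv"
    and "discrete_valuation absv"
    and "spherically_complete absv"
    and "na_banach_space absv scale nrm"
    and "1 \<le> q" and "1 \<le> r" and "1 \<le> v"
    and "1 / q + 1 / r = 1 / v"
    and "J \<in> L_op q absv scale nrm scale nrm"
    and "S \<in> L_op r absv scale nrm scale nrm"
    and "J \<circ> S = S \<circ> J"
  shows "J \<circ> S \<in> L_op v absv scale nrm scale nrm"
proof -
  interpret na_banach_space absv scale nrm
    by fact
  note nt = \<open>nontrivial_valuation absv\<close> and sc = \<open>spherically_complete absv\<close>
  note J = \<open>J \<in> L_op q absv scale nrm scale nrm\<close> and S = \<open>S \<in> L_op r absv scale nrm scale nrm\<close>
  note exps = \<open>1 / q + 1 / r = 1 / v\<close>
  have real: "\<exists>p'\<ge>1. p = ennreal p'" if "1 \<le> p" "p \<noteq> \<infinity>" for p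
    using that by (cases p) auto
  consider "q = \<infinity>" "r = \<infinity>" | "q = \<infinity>" "r \<noteq> \<infinity>" | "q \<noteq> \<infinity>" "r = \<infinity>" | "q \<noteq> \<infinity>" "r \<noteq> \<infinity>"
    by blast
  then show ?thesis
  proof cases
    case 1
    then have "v = \<infinity>"
      using exps by (simp add: divide_ennreal_def ennreal_inverse_inject)
    then show ?thesis
      using bounded_ops_compose[OF L_op_bounded[OF J] L_op_bounded[OF S]] by (simp add: L_op_def)
  next
    case 2
    then have "v = r"
      using exps by (simp add: divide_ennreal_def ennreal_inverse_inject)
    moreover obtain r' where "1 \<le> r'" "r = ennreal r'"
      using real[OF \<open>1 \<le> r\<close>] 2 by blast
    ultimately show ?thesis
      using L_op_compose_bounded_left[OF nt _ L_op_bounded[OF J], of r' S] S by simp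
  next
    case 3
    then have "v = q"
      using exps by (simp add: divide_ennreal_def ennreal_inverse_inject)
    moreover obtain q' where "1 \<le> q'" "q = ennreal q'"
      using real[OF \<open>1 \<le> q\<close>] 3 by blast
    ultimately show ?thesis
      using L_op_compose_bounded_right[OF nt _ _ L_op_bounded[OF S], of q' J] J by simp
  next
    case 4
    obtain q' where q: "1 \<le> q'" "q = ennreal q'"
      using real[OF \<open>1 \<le> q\<close>] 4 by blast
    obtain r' where r: "1 \<le> r'" "r = ennreal r'"
      using real[OF \<open>1 \<le> r\<close>] 4 by blast
    have sum: "1 / v = ennreal (1 / q' + 1 / r')"
      unfolding exps[symmetric] q(2) r(2) using q(1) r(1)
      by (simp add: divide_ennreal ennreal_plus flip: ennreal_1)
    have "v \<noteq> \<infinity>"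
    proof
      assume "v = \<infinity>"
      then have "ennreal (1 / q' + 1 / r') = 0"
        using sum by simp
      then have "1 / q' + 1 / r' \<le> 0"
        by (simp add: ennreal_eq_0_iff)
      then show False
        using q(1) r(1) by (smt (verit) divide_pos_pos)
    qed
    then obtain v' where v: "1 \<le> v'" "v = ennreal v'"
      using real[OF \<open>1 \<le> v\<close>] by blast
    have "ennreal (1 / v') = ennreal (1 / q' + 1 / r')"
      using sum v by (simp add: divide_ennreal flip: ennreal_1)
    then have "1 / q' + 1 / r' = 1 / v'"
      using q(1) r(1) v(1) by (subst (asm) ennreal_inj) auto
    then show ?thesis
      using L_op_compose_finite[OF nt sc, of q' r' v' J S] J S q r v by simp
  qed
qed

end
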